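(* If $G$ is a graph such that its complement $G^c$ has girth at least five, then $\mathrm{lbox}(G)\ge\left\lfloor\tfrac{\mathrm{ad}(G^c)}{2}+1\right\rfloor$.
   Context: All graphs are finite and simple, with nonempty vertex set. The girth of a graph is the length of a shortest cycle (infinite if the graph is acyclic). For a graph $H=(V,E)$, $\mathrm{ad}(H)=2|E|/|V|$ is its average degree. A real interval is either a bounded interval of $\mathbb{R}$ or $\mathbb{R}$ itself. For an integer $d'\ge 1$, a $d'$-box is a Cartesian product $I_1\times\cdots\times I_{d'}$ of real intervals; it is local in dimension $i$ if $I_i$ is bounded. A $d$-local box in dimension $d'\ge d$ is a $d'$-box that is local in at most $d$ dimensions. The local boxicity $\mathrm{lbox}(G)$ of a graph $G$ is the minimum integer $d$ such that, for some $d'$, there are $d$-local boxes $(B_v)_{v\in V(G)}$ in dimension $d'$ such that two distinct vertices $u,v$ are adjacent in $G$ if and only if $B_u\cap B_v\neq\emptyset$.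
   Formalization: Local boxicity is taken as the minimum over d ≥ 1, and intervals are nonempty; with d = 0 allowed, a complete graph would have local boxicity 0 while the claimed bound is 1, so the statement would fail exactly for complete graphs. *)

theory Defs
  imports "HOL-Analysis.Analysis" "Graph_Theory.Pair_Digraph"
begin

text \<open>
  A finite simple graph is a \<^locale>\<open>pair_graph\<close>: a finite, loop-free, symmetric digraph without
  parallel arcs. An undirected edge \<open>{u, v}\<close> is the pair of arcs \<open>(u, v)\<close> and \<open>(v, u)\<close>.
\<close>

definition edge_set :: "'a pair_pre_digraph \<Rightarrow> 'a set set" where
  "edge_set H = (\<lambda>(u, v). {u, v}) ` parcs H"

definition graph_complement :: "'a pair_pre_digraph \<Rightarrow> 'a pair_pre_digraph" where
  "graph_complement G =
    \<lparr> pverts = pverts G,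
      parcs = {(u, v). u \<in> pverts G \<and> v \<in> pverts G \<and> u \<noteq> v \<and> (u, v) \<notin> parcs G} \<rparr>"

text \<open>
  The library's \<^const>\<open>pre_digraph.cycle\<close> is a directed notion and counts \<open>u, v, u\<close> as a cycle of
  length 2 in a symmetric digraph; the cycles of an undirected simple graph are the directed
  cycles of length at least 3. The infimum of the empty set in \<^typ>\<open>enat\<close> is \<open>\<infinity>\<close>.
\<close>

definition girth :: "'a pair_pre_digraph \<Rightarrow> enat" where
  "girth H = (INF p \<in> {p. pre_digraph.cycle (with_proj H) p \<and> 3 \<le> length p}. enat (length p))"

definition average_degree :: "'a pair_pre_digraph \<Rightarrow> real" where
  "average_degree H = 2 * real (card (edge_set H)) / real (card (pverts H))"

text \<open>
  Intervals are nonempty, as usual for interval representations of graphs; bounded intervals may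
  be open, closed or half-open.
\<close>

definition real_interval :: "real set \<Rightarrow> bool" where
  "real_interval I \<longleftrightarrow> I \<noteq> {} \<and> is_interval I \<and> (bounded I \<or> I = UNIV)"

text \<open>
  A \<open>d'\<close>-box is given by its sequence of factors \<open>I 0, \<dots>, I (d' - 1)\<close>; the values \<open>I i\<close> for
  \<open>i \<ge> d'\<close> are irrelevant. The box as a set of points is \<open>box_points d' I\<close>.
\<close>

definition is_dbox :: "nat \<Rightarrow> (nat \<Rightarrow> real set) \<Rightarrow> bool" where
  "is_dbox d' I \<longleftrightarrow> 1 \<le> d' \<and> (\<forall>i<d'. real_interval (I i))"

definition box_points :: "nat \<Rightarrow> (nat \<Rightarrow> real set) \<Rightarrow> (nat \<Rightarrow> real) set" where
  "box_points d' I = (\<Pi>\<^sub>E i\<in>{..<d'}. I i)"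

definition local_dbox :: "nat \<Rightarrow> nat \<Rightarrow> (nat \<Rightarrow> real set) \<Rightarrow> bool" where
  "local_dbox d d' I \<longleftrightarrow> d \<le> d' \<and> is_dbox d' I \<and> card {i. i < d' \<and> bounded (I i)} \<le> d"

definition has_local_box_rep :: "'a pair_pre_digraph \<Rightarrow> nat \<Rightarrow> bool" where
  "has_local_box_rep G d \<longleftrightarrow>
    (\<exists>d' B. (\<forall>v\<in>pverts G. local_dbox d d' (B v)) \<and>
      (\<forall>u\<in>pverts G. \<forall>v\<in>pverts G. u \<noteq> v \<longrightarrow>
        ((u, v) \<in> parcs G \<longleftrightarrow> box_points d' (B u) \<inter> box_points d' (B v) \<noteq> {})))"

text \<open>
  The local boxicity is a positive integer. This convention only concerns complete graphs, which
  are precisely the graphs with a representation by \<open>0\<close>-local boxes (lemma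
  \<open>has_local_box_rep_0_iff\<close>); they get local boxicity 1. The minimum exists for every finite graph
  (lemma \<open>has_local_box_rep_exists\<close>).
\<close>

definition lbox :: "'a pair_pre_digraph \<Rightarrow> nat" where
  "lbox G = (LEAST d. 1 \<le> d \<and> has_local_box_rep G d)"

lemma real_interval_UNIV: "real_interval UNIV"
  by (simp add: real_interval_def)

lemma real_interval_singleton: "real_interval {x}"
  by (simp add: real_interval_def is_interval_1)

lemma has_local_box_rep_0_iff:
  "has_local_box_rep G 0 \<longleftrightarrow> (\<forall>u\<in>pverts G. \<forall>v\<in>pverts G. u \<noteq> v \<longrightarrow> (u, v) \<in> parcs G)"
proof
  assume "has_local_box_rep G 0"
  then obtain d' B where B: "\<And>v. v \<in> pverts G \<Longrightarrow> local_dbox 0 d' (B v)"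
    and adj: "\<And>u v. u \<in> pverts G \<Longrightarrow> v \<in> pverts G \<Longrightarrow> u \<noteq> v \<Longrightarrow>
        (u, v) \<in> parcs G \<longleftrightarrow> box_points d' (B u) \<inter> box_points d' (B v) \<noteq> {}"
    unfolding has_local_box_rep_def by metis
  have "box_points d' (B v) = (\<Pi>\<^sub>E i\<in>{..<d'}. UNIV)" if "v \<in> pverts G" for v
    using B[OF that]
    by (auto simp: local_dbox_def is_dbox_def real_interval_def box_points_def intro!: PiE_cong)
  moreover have "(\<Pi>\<^sub>E i\<in>{..<d'}. UNIV :: real set) \<noteq> {}"
    by (simp add: PiE_eq_empty_iff)
  ultimately show "\<forall>u\<in>pverts G. \<forall>v\<in>pverts G. u \<noteq> v \<longrightarrow> (u, v) \<in> parcs G"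
    using adj by auto
next
  assume "\<forall>u\<in>pverts G. \<forall>v\<in>pverts G. u \<noteq> v \<longrightarrow> (u, v) \<in> parcs G"
  then show "has_local_box_rep G 0"
    unfolding has_local_box_rep_def
    by (intro exI[of _ "1::nat"] exI[of _ "\<lambda>_ _. UNIV"])
       (auto simp: local_dbox_def is_dbox_def box_points_def real_interval_UNIV PiE_eq_empty_iff
          not_bounded_UNIV)
qed

lemma has_local_box_rep_exists:
  assumes "pair_graph G"
  shows "\<exists>d\<ge>1. has_local_box_rep G d"
proof -
  interpret pair_graph G by fact
  define N where "N = parcs (graph_complement G)"
  have "N \<subseteq> pverts G \<times> pverts G"
    by (auto simp: N_def graph_complement_def)
  then have "finite N"
    using finite_subset pair_finite_verts by blast
  then obtain f where f: "bij_betw f {..<card N} N"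
    using bij_betw_from_nat_into_finite by blast
  define d where "d = Suc (card N)"
  define B :: "'a \<Rightarrow> nat \<Rightarrow> real set" where
    "B v i = (if i < card N \<and> v = fst (f i) then {0}
              else if i < card N \<and> v = snd (f i) then {1} else UNIV)" for v i
  have int: "real_interval (B v i)" for v i
    by (simp add: B_def real_interval_UNIV real_interval_singleton)
  have "card {i. i < d \<and> bounded (B v i)} \<le> card {..<d}" for v
    by (rule card_mono) auto
  then have "local_dbox d d (B v)" for v
    using int by (auto simp: local_dbox_def is_dbox_def d_def)
  moreover have "(u, v) \<in> parcs G \<longleftrightarrow> box_points d (B u) \<inter> box_points d (B v) \<noteq> {}"
    if uv: "u \<in> pverts G" "v \<in> pverts G" "u \<noteq> v" for u v
  proof -
    have meet: "box_points d (B u) \<inter> box_points d (B v) \<noteq> {} \<longleftrightarrow> (\<forall>i<d. B u i \<inter> B v i \<noteq> {})"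
      by (auto simp: box_points_def PiE_Int PiE_eq_empty_iff)
    show ?thesis
    proof
      assume uv_adj: "(u, v) \<in> parcs G"
      have "B u i \<inter> B v i \<noteq> {}" if "i < d" for i
      proof (rule ccontr)
        assume "\<not> B u i \<inter> B v i \<noteq> {}"
        then have "i < card N" "f i = (u, v) \<or> f i = (v, u)"
          using uv by (auto simp: B_def prod_eq_iff split: if_splits)
        then have "(u, v) \<in> N \<or> (v, u) \<in> N"
          using bij_betwE[OF f] by (metis lessThan_iff)
        moreover have "(v, u) \<in> parcs G"
          using uv_adj arcs_symmetric by auto
        ultimately show False
          using uv_adj by (auto simp: N_def graph_complement_def)
      qed
      then show "box_points d (B u) \<inter> box_points d (B v) \<noteq> {}"
        by (simp add: meet)
    next
      assume ne: "box_points d (B u) \<inter> box_points d (B v) \<noteq> {}"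
      show "(u, v) \<in> parcs G"
      proof (rule ccontr)
        assume "(u, v) \<notin> parcs G"
        then have "(u, v) \<in> N"
          using uv by (simp add: N_def graph_complement_def)
        then obtain i where i: "i < card N" "f i = (u, v)"
          using f by (metis bij_betw_iff_bijections lessThan_iff)
        then have "B u i \<inter> B v i = {}"
          using uv by (simp add: B_def)
        moreover have "i < d"
          using i by (simp add: d_def)
        ultimately show False
          using ne unfolding meet by blast
      qed
    qed
  qed
  ultimately have "has_local_box_rep G d"
    unfolding has_local_box_rep_def by blast
  then show ?thesis
    by (intro exI[of _ d]) (simp add: d_def)
qed

end

theory Submission
  imports Defs
begin

text \<open>
  In one dimension of a local box representation of \<open>G\<close>, the pairs of disjoint intervals, ordered
  from left to right, form an interval order. All these pairs are edges of the complement of \<open>G\<close>,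
  which has no triangle and no quadrilateral, so the comparability graph of the order is a forest:
  there are fewer such pairs than bounded intervals, unless there is no pair at all. Every edge of
  the complement arises in some dimension, and each vertex has at most \<open>d\<close> bounded intervals.
  Summing over the dimensions, the complement has fewer than \<open>d * n\<close> edges if it has any, where
  \<open>n\<close> is the number of vertices.
\<close>

section \<open>Interval orders with few comparable pairs\<close>

text \<open>
  By \<open>ferrers\<close>, the upper neighbourhoods of the elements form a chain under inclusion. By
  \<open>no_square\<close>, every \<open>a\<close> other than some \<open>m\<close> with the largest neighbourhood has at most one upper neighbour.
  Sending \<open>(m, b)\<close> to \<open>b\<close> and every other \<open>(a, b)\<close> to \<open>a\<close> is then injective and misses \<open>m\<close>.
\<close>
lemma card_interval_order_less:
  assumes "finite S" "R \<subseteq> S \<times> S" "R \<noteq> {}"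
    and ferrers: "\<And>a b c d. (a, b) \<in> R \<Longrightarrow> (c, d) \<in> R \<Longrightarrow> (a, d) \<in> R \<or> (c, b) \<in> R"
    and no_chain: "\<And>a b c. (a, b) \<in> R \<Longrightarrow> (b, c) \<notin> R"
    and no_square: "\<And>a b c d. (a, b) \<in> R \<Longrightarrow> (a, d) \<in> R \<Longrightarrow> (c, b) \<in> R \<Longrightarrow> (c, d) \<in> R \<Longrightarrow>
      a = c \<or> b = d"
  shows "card R < card S"
proof -
  have fin: "finite (R `` {a})" for a
    by (rule finite_subset[OF _ \<open>finite S\<close>]) (use assms(2) in auto)
  define m where "m = (ARG_MAX (\<lambda>a. card (R `` {a})) a. a \<in> Domain R)"
  \<comment> \<open>\<open>ARG_MAX\<close> attains its maximum only if the values are bounded;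
    \<open>Suc (card S)\<close> is a strict bound.\<close>
  have "card (R `` {a}) < Suc (card S)" for a
    using assms(1,2) by (intro le_imp_less_Suc card_mono) auto
  moreover obtain k where "k \<in> Domain R"
    using assms(3) by auto
  ultimately have "m \<in> Domain R \<and> (\<forall>a. a \<in> Domain R \<longrightarrow> card (R `` {a}) \<le> card (R `` {m}))"
    unfolding m_def by (intro arg_max_nat_lemma[of _ k]) auto
  then have m: "m \<in> Domain R" and max: "\<And>a. a \<in> Domain R \<Longrightarrow> card (R `` {a}) \<le> card (R `` {m})"
    by auto
  have sub: "R `` {a} \<subseteq> R `` {m}" for a
  proof (rule ccontr)
    assume "\<not> R `` {a} \<subseteq> R `` {m}"
    then obtain b where b: "(a, b) \<in> R" "(m, b) \<notin> R"
      by auto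
    \<comment> \<open>For \<open>(m, d)\<close> in \<open>R\<close>, \<open>ferrers\<close> leaves
      only \<open>(a, d)\<close>, because \<open>(m, b)\<close> is excluded.\<close>
    then have "R `` {m} \<subset> R `` {a}"
      using ferrers[OF b(1)] by blast
    then have "card (R `` {m}) < card (R `` {a})"
      by (rule psubset_card_mono[OF fin])
    then show False
      using max[of a] b(1) by (simp add: DomainI leD)
  qed
  have unique: "b = b'" if "(a, b) \<in> R" "(a, b') \<in> R" "a \<noteq> m" for a b b'
    using no_square[of a b b' m] sub[of a] that by blast
  define f where "f = (\<lambda>(a, b). if a = m then b else a)"
  have "inj_on f R"
  proof (rule inj_onI)
    fix p q assume pq: "p \<in> R" "q \<in> R" "f p = f q"
    obtain a b c d where "p = (a, b)" "q = (c, d)"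
      by fastforce
    with pq show "p = q"
      \<comment> \<open>A collision of \<open>(m, b)\<close> with \<open>(b, d)\<close>, where
        \<open>b\<close> is not \<open>m\<close>, would be a chain; this is the only mixed
        case.\<close>
      using no_chain[of a b d] no_chain[of c d b] unique[of a b d]
      by (auto simp: f_def split: if_splits)
  qed
  moreover have "f ` R \<subseteq> S - {m}"
    using assms(2) m no_chain by (auto simp: f_def split: if_splits)
  ultimately have "card R \<le> card (S - {m})"
    using \<open>finite S\<close> by (intro card_inj_on_le) auto
  also have "\<dots> < card S"
    using m assms(1,2) by (intro psubset_card_mono) auto
  finally show ?thesis .
qed

section \<open>Real intervals ordered from left to right\<close>

definition left_of :: "real set \<Rightarrow> real set \<Rightarrow> bool" where
  "left_of I J \<longleftrightarrow> (\<forall>x\<in>I. \<forall>y\<in>J. x < y)"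

lemma left_of_disjoint: "left_of I J \<Longrightarrow> I \<inter> J = {}"
  by (auto simp: left_of_def)

lemma left_of_trans: "left_of I J \<Longrightarrow> left_of J K \<Longrightarrow> J \<noteq> {} \<Longrightarrow> left_of I K"
  by (meson all_not_in_conv left_of_def less_trans)

text \<open>If both alternatives fail, there are x in \<open>I\<close>, w in \<open>J\<close>, z in
  \<open>K\<close>, y in \<open>L\<close> with y \<le> x and w \<le> z, so x < w \<le> z < y \<le>
  x.\<close>

lemma left_of_ferrers: "left_of I J \<Longrightarrow> left_of K L \<Longrightarrow> left_of I L \<or> left_of K J"
  unfolding left_of_def by (meson le_less_trans less_trans not_le)

lemma disjoint_intervals_left_of:
  assumes "is_interval I" "is_interval J" "I \<inter> J = {}"
  shows "left_of I J \<or> left_of J I"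
proof (rule ccontr)
  assume "\<not> ?thesis"
  then obtain x y x' y' where xy: "x \<in> I" "y \<in> J" "y \<le> x" "x' \<in> I" "y' \<in> J" "x' \<le> y'"
    by (auto simp: left_of_def not_less)
  show False
  \<comment> \<open>Either y lies between x' and x, hence in \<open>I\<close>, or x' lies between y
    and y', hence in \<open>J\<close>.\<close>
  proof (cases "x' \<le> y")
    case True
    then have "y \<in> I"
      using mem_is_interval_1_I[OF assms(1)] xy by blast
    then show False
      using assms(3) xy by blast
  next
    case False
    then have "x' \<in> J"
      using mem_is_interval_1_I[OF assms(2), of y y' x'] xy by simp
    then show False
      using assms(3) xy by blast
  qed
qed

lemma box_points_disjoint_iff:
  "box_points d I \<inter> box_points d J = {} \<longleftrightarrow> (\<exists>i<d. I i \<inter> J i = {})"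
  by (auto simp: box_points_def PiE_Int PiE_eq_empty_iff)

section \<open>Triangles and quadrilaterals bound the girth\<close>

lemma girth_le_cycle:
  assumes "pre_digraph.cycle (with_proj H) p" "3 \<le> length p"
  shows "girth H \<le> enat (length p)"
  unfolding girth_def using assms by (intro INF_lower) auto

lemma girth_triangle:
  assumes "{(a, b), (b, c), (c, a)} \<subseteq> parcs H" "{a, b, c} \<subseteq> pverts H" "distinct [a, b, c]"
  shows "girth H \<le> 3"
proof -
  have "pre_digraph.cycle (with_proj H) [(a, b), (b, c), (c, a)]"
    using assms unfolding pre_digraph.cycle_def
    by (intro exI[of _ a])
       (auto simp: pre_digraph.awalk_def pre_digraph.cas.simps pre_digraph.awalk_verts.simps)
  then show ?thesis
    by (auto dest!: girth_le_cycle simp: numeral_eq_enat eval_nat_numeral)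
qed

lemma girth_square:
  assumes "{(a, b), (b, c), (c, d), (d, a)} \<subseteq> parcs H" "{a, b, c, d} \<subseteq> pverts H"
    and "distinct [a, b, c, d]"
  shows "girth H \<le> 4"
proof -
  have "pre_digraph.cycle (with_proj H) [(a, b), (b, c), (c, d), (d, a)]"
    using assms unfolding pre_digraph.cycle_def
    by (intro exI[of _ a])
       (auto simp: pre_digraph.awalk_def pre_digraph.cas.simps pre_digraph.awalk_verts.simps)
  then show ?thesis
    by (auto dest!: girth_le_cycle simp: numeral_eq_enat eval_nat_numeral)
qed

section \<open>Counting disjoint pairs and complement edges\<close>

text \<open>Comparable pairs are edges of \<open>H\<close>. By transitivity a chain closes to a
  triangle, and two elements with two common upper neighbours span a quadrilateral; the girth
  forbids both.\<close>

lemma card_left_of_less: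
  fixes H :: "'a pair_pre_digraph" and I :: "'a \<Rightarrow> real set" and S :: "'a set"
  defines "R \<equiv> {(u, v) \<in> S \<times> S. left_of (I u) (I v)}"
  assumes girth: "girth H \<ge> 5" and "finite S" "S \<subseteq> pverts H" "R \<noteq> {}"
    and nonempty: "\<And>v. v \<in> S \<Longrightarrow> I v \<noteq> {}"
    and disjoint_adj: "\<And>u v. u \<in> S \<Longrightarrow> v \<in> S \<Longrightarrow> I u \<inter> I v = {} \<Longrightarrow> (u, v) \<in> parcs H"
  shows "card R < card S"
proof -
  have arc: "(u, v) \<in> parcs H" "(v, u) \<in> parcs H" "u \<noteq> v" "u \<in> pverts H" "v \<in> pverts H"
    if "(u, v) \<in> R" for u v
    using that left_of_disjoint[of "I u" "I v"] disjoint_adj nonempty \<open>S \<subseteq> pverts H\<close>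
    by (auto simp: R_def Int_commute)
  have no_chain: "(b, c) \<notin> R" if ab: "(a, b) \<in> R" for a b c
  proof
    assume bc: "(b, c) \<in> R"
    have ac: "(a, c) \<in> R"
      using ab bc left_of_trans nonempty by (auto simp: R_def)
    have "girth H \<le> 3"
      by (rule girth_triangle[of a b c]) (use arc[OF ab] arc[OF bc] arc[OF ac] in auto)
    with girth have "(5 :: enat) \<le> 3"
      by (rule order_trans)
    then show False
      by simp
  qed
  show ?thesis
  proof (rule card_interval_order_less[OF \<open>finite S\<close> _ \<open>R \<noteq> {}\<close>])
    show "R \<subseteq> S \<times> S"
      by (auto simp: R_def)
    show "(a, d) \<in> R \<or> (c, b) \<in> R" if "(a, b) \<in> R" "(c, d) \<in> R" for a b c d
      using that left_of_ferrers by (auto simp: R_def)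
    show "(b, c) \<notin> R" if "(a, b) \<in> R" for a b c
      using no_chain that .
    show "a = c \<or> b = d"
      if R: "(a, b) \<in> R" "(a, d) \<in> R" "(c, b) \<in> R" "(c, d) \<in> R" for a b c d
    proof (rule ccontr)
      assume "\<not> (a = c \<or> b = d)"
      \<comment> \<open>Consecutive vertices differ because their intervals are disjoint and
        nonempty, opposite ones by assumption.\<close>
      then have "girth H \<le> 4"
        by (intro girth_square[of a b c d]) (use R[THEN arc(1)] R[THEN arc(2)] R[THEN arc(3)]
            R[THEN arc(4)] R[THEN arc(5)] in auto)
      with girth have "(5 :: enat) \<le> 4"
        by (rule order_trans)
      then show False
        by simp
    qed
  qed
qed

lemma card_edge_set_complement_less:
  assumes "pair_graph G" "pverts G \<noteq> {}" "girth (graph_complement G) \<ge> 5"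
    and "1 \<le> d" "has_local_box_rep G d"
  shows "card (edge_set (graph_complement G)) < d * card (pverts G)"
proof -
  interpret pair_graph G by fact
  let ?H = "graph_complement G"
  obtain d' B where box: "\<And>v. v \<in> pverts G \<Longrightarrow> local_dbox d d' (B v)"
    and adj: "\<And>u v. u \<in> pverts G \<Longrightarrow> v \<in> pverts G \<Longrightarrow> u \<noteq> v \<Longrightarrow>
      (u, v) \<in> parcs G \<longleftrightarrow> box_points d' (B u) \<inter> box_points d' (B v) \<noteq> {}"
    using \<open>has_local_box_rep G d\<close> unfolding has_local_box_rep_def by metis
  have int: "is_interval (B v i)" "B v i \<noteq> {}" "bounded (B v i) \<or> B v i = UNIV"
    if "v \<in> pverts G" "i < d'" for v i
    using box[OF that(1)] that(2) by (auto simp: local_dbox_def is_dbox_def real_interval_def)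
  have compl_iff: "(u, v) \<in> parcs ?H \<longleftrightarrow> (\<exists>i<d'. B u i \<inter> B v i = {})"
    if "u \<in> pverts G" "v \<in> pverts G" for u v
  proof (cases "u = v")
    case True
    then show ?thesis
      using int that by (auto simp: graph_complement_def)
  next
    case False
    then show ?thesis
      using adj[OF that] that by (auto simp: graph_complement_def box_points_disjoint_iff)
  qed
  define S where "S i = {v \<in> pverts G. bounded (B v i)}" for i
  define R where "R i = {(u, v) \<in> S i \<times> S i. left_of (B u i) (B v i)}" for i
  have fin_S: "finite (S i)" for i
    by (simp add: S_def)
  have fin_R: "finite (R i)" for i
    by (rule finite_subset[of _ "S i \<times> S i"]) (auto simp: R_def fin_S)
  have R_less: "card (R i) < card (S i)" if "i < d'" "R i \<noteq> {}" for i
    unfolding R_def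
  proof (rule card_left_of_less[OF assms(3) fin_S])
    show "S i \<subseteq> pverts ?H"
      by (auto simp: S_def graph_complement_def)
    show "{(u, v) \<in> S i \<times> S i. left_of (B u i) (B v i)} \<noteq> {}"
      using that(2) by (simp add: R_def)
    show "B v i \<noteq> {}" if "v \<in> S i" for v
      using that int \<open>i < d'\<close> by (auto simp: S_def)
    show "(u, v) \<in> parcs ?H" if "u \<in> S i" "v \<in> S i" "B u i \<inter> B v i = {}" for u v
      using that compl_iff \<open>i < d'\<close> by (auto simp: S_def)
  qed
  have "edge_set ?H \<subseteq> (\<Union>i<d'. (\<lambda>(u, v). {u, v}) ` R i)"
  proof
    fix e assume "e \<in> edge_set ?H"
    then obtain u v where e: "e = {u, v}" "(u, v) \<in> parcs ?H"
      by (auto simp: edge_set_def)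
    then have uv: "u \<in> pverts G" "v \<in> pverts G"
      by (auto simp: graph_complement_def)
    then obtain i where i: "i < d'" "B u i \<inter> B v i = {}"
      using compl_iff e(2) by blast
    \<comment> \<open>An unbounded factor is \<open>UNIV\<close>, which meets every nonempty
      interval, so both factors are bounded.\<close>
    then have "u \<in> S i" "v \<in> S i"
      using int[OF uv(1) i(1)] int[OF uv(2) i(1)] uv by (auto simp: S_def)
    moreover have "left_of (B u i) (B v i) \<or> left_of (B v i) (B u i)"
      using disjoint_intervals_left_of int uv i by simp
    ultimately have "(u, v) \<in> R i \<or> (v, u) \<in> R i"
      by (auto simp: R_def)
    then show "e \<in> (\<Union>i<d'. (\<lambda>(u, v). {u, v}) ` R i)"
      using e(1) i(1) by (force simp: insert_commute)
  qed
  then have "card (edge_set ?H) \<le> card (\<Union>i<d'. (\<lambda>(u, v). {u, v}) ` R i)"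
    by (intro card_mono) (auto simp: fin_R)
  also have "\<dots> \<le> (\<Sum>i<d'. card ((\<lambda>(u, v). {u, v}) ` R i))"
    by (rule card_UN_le) simp
  also have "\<dots> \<le> (\<Sum>i<d'. card (R i))"
    by (intro sum_mono card_image_le fin_R)
  finally have edges: "card (edge_set ?H) \<le> (\<Sum>i<d'. card (R i))" .
  \<comment> \<open>Double counting of the pairs \<open>(v, i)\<close> with \<open>B v i\<close>
    bounded.\<close>
  have "(\<Sum>i<d'. card (S i)) = (\<Sum>i<d'. \<Sum>v\<in>pverts G. if bounded (B v i) then 1 else 0)"
    unfolding S_def by (simp flip: sum.inter_filter)
  also have "\<dots> = (\<Sum>v\<in>pverts G. card {i. i < d' \<and> bounded (B v i)})"
    by (subst sum.swap) (simp flip: sum.inter_filter)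
  also have "\<dots> \<le> (\<Sum>v\<in>pverts G. d)"
    using box by (intro sum_mono) (auto simp: local_dbox_def)
  finally have dims: "(\<Sum>i<d'. card (S i)) \<le> d * card (pverts G)"
    by (simp add: mult.commute)
  show ?thesis
  proof (cases "\<forall>i<d'. R i = {}")
    \<comment> \<open>Here the complement has no edges; strictness comes from
      \<open>1 \<le> d\<close> and the nonempty vertex set.\<close>
    case True
    then show ?thesis
      using edges \<open>1 \<le> d\<close> \<open>pverts G \<noteq> {}\<close> by (simp add: card_gt_0_iff)
  next
    case False
    then obtain j where "j < d'" "R j \<noteq> {}"
      by blast
    moreover have "card (R i) \<le> card (S i)" if "i < d'" for i
      using R_less[OF that] by (cases "R i = {}") auto
    \<comment> \<open>One dimension \<open>j\<close> with a disjoint pair suffices for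
      strictness.\<close>
    ultimately have "(\<Sum>i<d'. card (R i)) < (\<Sum>i<d'. card (S i))"
      by (intro sum_strict_mono_ex1) (use R_less in auto)
    then show ?thesis
      using edges dims by linarith
  qed
qed

theorem theorem1p5:
  fixes G :: "'a pair_pre_digraph"
  assumes "pair_graph G"
    and "pverts G \<noteq> {}"
    and "girth (graph_complement G) \<ge> 5"
  shows "int (lbox G) \<ge> \<lfloor>average_degree (graph_complement G) / 2 + 1\<rfloor>"
proof -
  interpret pair_graph G by fact
  have "1 \<le> lbox G \<and> has_local_box_rep G (lbox G)"
    unfolding lbox_def using has_local_box_rep_exists[OF assms(1)] by (rule LeastI_ex)
  then have "card (edge_set (graph_complement G)) < lbox G * card (pverts G)"
    using card_edge_set_complement_less assms by blast
  then have "real (card (edge_set (graph_complement G))) < real (lbox G) * real (card (pverts G))"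
    by (metis of_nat_less_iff of_nat_mult)
  moreover have "0 < card (pverts G)"
    using assms(2) by (simp add: card_gt_0_iff)
  ultimately have "average_degree (graph_complement G) / 2 < real (lbox G)"
    by (simp add: average_degree_def graph_complement_def divide_less_eq)
  then show ?thesis
    \<comment> \<open>Since \<open>lbox G\<close> is an integer, the strict inequality absorbs the
      summand 1 under the floor.\<close>
    by linarith
qed

end
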